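(* Let $\mathscr H=(V,E)$ be a hypergraph such that $\mathrm{Bip}\,\mathscr H$ is connected. The polynomials $$I_{\mathscr H}(\xi)=\sum_f\xi^{\bar\iota(f)}\quad\text{and}\quad X_{\mathscr H}(\eta)=\sum_f\eta^{\bar\varepsilon(f)},$$ where both sums are over all hypertrees $f$ in $\mathscr H$ and $\bar\iota(f)$, $\bar\varepsilon(f)$ denote the numbers of internally, respectively externally, inactive hyperedges with respect to $f$ and a chosen total order on $E$, do not depend on the chosen order of the hyperedges.
   Context: A hypergraph is a pair $\mathscr H=(V,E)$ with $V$ a finite set and $E$ a finite multiset of non-empty subsets of $V$ (hyperedges). $\mathrm{Bip}\,\mathscr H$ is the bipartite graph with color classes $V$ and $E$, with $v$ joined to $e$ iff $v\in e$. A hypertree in $\mathscr H$ is a function $f\colon E\to\mathbf N=\{0,1,2,\ldots\}$ such that some spanning tree of $\mathrm{Bip}\,\mathscr H$ has degree $f(e)+1$ at each $e\in E$. A hypertree $f$ is such that a transfer of valence is possible from $a\in E$ to $b\in E$ ($a\neq b$) if the function obtained from $f$ by decreasing $f(a)$ by $1$ and increasing $f(b)$ by $1$ is also a hypertree. Given a total order on $E$, a hyperedge $e$ is internally inactive with respect to $f$ if $f$ is such that a transfer of valence is possible from $e$ to some hyperedge smaller than $e$; it is externally inactive with respect to $f$ if a transfer of valence is possible to $e$ from some hyperedge smaller than $e$. *)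

theory Defs
  imports
    "Graph_Theory.Graph_Theory"
    "HOL-Library.FuncSet"
    "HOL-Computational_Algebra.Polynomial"
begin

section \<open>Trees in undirected graphs\<close>

text \<open>
  Undirected graphs are symmetric digraphs, as in \<^theory>\<open>Graph_Theory.Digraph\<close>: each edge is a pair of
  opposite arcs. The constants \<open>tree\<close> and \<open>spanning_tree\<close> of \<open>Graph_Theory\<close> are unsuitable
  here: their acyclicity condition concerns directed cycles, and a pair of opposite arcs already
  forms one. A cycle of a simple undirected graph is a directed cycle of length at least 3.
\<close>

definition undirected_tree :: "'a pair_pre_digraph \<Rightarrow> bool" where
  "undirected_tree T \<longleftrightarrow>
     pair_graph T \<and> Digraph_Component.connected (with_proj T) \<and>
     \<not> (\<exists>p. pre_digraph.cycle (with_proj T) p \<and> 3 \<le> length p)"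

definition undirected_spanning_tree :: "'a pair_pre_digraph \<Rightarrow> 'a pair_pre_digraph \<Rightarrow> bool" where
  "undirected_spanning_tree T G \<longleftrightarrow>
     undirected_tree T \<and> spanning (with_proj T) (with_proj G)"

section \<open>Hypergraphs and hypertrees\<close>

text \<open>
  The finite multiset of hyperedges is represented as a family \<open>members\<close> indexed by the finite set
  \<open>hyperedges\<close>. Distinct indices may carry the same subset of \<open>vertices\<close>, so they stand for the
  individual copies of the elements of the multiset.
\<close>

record ('v, 'e) pre_hypergraph =
  vertices :: "'v set"
  hyperedges :: "'e set"
  members :: "'e \<Rightarrow> 'v set"

definition hypergraph :: "('v, 'e) pre_hypergraph \<Rightarrow> bool" where
  "hypergraph H \<longleftrightarrow>
     finite (vertices H) \<and> finite (hyperedges H) \<and>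
     (\<forall>e \<in> hyperedges H. members H e \<noteq> {} \<and> members H e \<subseteq> vertices H)"

definition Bip :: "('v, 'e) pre_hypergraph \<Rightarrow> ('v + 'e) pair_pre_digraph" where
  "Bip H =
     \<lparr> pverts = vertices H <+> hyperedges H,
       parcs =
         {(Inl v, Inr e) | v e. v \<in> vertices H \<and> e \<in> hyperedges H \<and> v \<in> members H e} \<union>
         {(Inr e, Inl v) | v e. v \<in> vertices H \<and> e \<in> hyperedges H \<and> v \<in> members H e} \<rparr>"

text \<open>
  Functions on \<open>hyperedges H\<close> are taken to be extensional, so that distinct elements of
  \<open>hypertrees H\<close> differ on \<open>hyperedges H\<close>. In a symmetric digraph without parallel arcs, the
  out-degree of a vertex is its undirected degree.
\<close>

definition hypertrees :: "('v, 'e) pre_hypergraph \<Rightarrow> ('e \<Rightarrow> nat) set" where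
  "hypertrees H =
     {f \<in> hyperedges H \<rightarrow>\<^sub>E UNIV.
        \<exists>T. undirected_spanning_tree T (Bip H) \<and>
            (\<forall>e \<in> hyperedges H. out_degree (with_proj T) (Inr e) = f e + 1)}"

text \<open>
  If \<open>f a = 0\<close>, decreasing \<open>f a\<close> leaves the natural numbers, hence the positivity condition.
\<close>

definition transfer_possible ::
    "('v, 'e) pre_hypergraph \<Rightarrow> ('e \<Rightarrow> nat) \<Rightarrow> 'e \<Rightarrow> 'e \<Rightarrow> bool" where
  "transfer_possible H f a b \<longleftrightarrow>
     a \<in> hyperedges H \<and> b \<in> hyperedges H \<and> a \<noteq> b \<and> 0 < f a \<and>
     f(a := f a - 1, b := f b + 1) \<in> hypertrees H"

section \<open>Inactivity and the two polynomials\<close>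

text \<open>
  A total order on the hyperedges is a reflexive relation \<open>r\<close>; \<open>b\<close> is smaller than \<open>e\<close> iff
  \<open>(b, e) \<in> r\<close> and \<open>b \<noteq> e\<close>.
\<close>

definition internally_inactive ::
    "('v, 'e) pre_hypergraph \<Rightarrow> 'e rel \<Rightarrow> ('e \<Rightarrow> nat) \<Rightarrow> 'e set" where
  "internally_inactive H r f =
     {e \<in> hyperedges H.
        \<exists>b \<in> hyperedges H. (b, e) \<in> r \<and> b \<noteq> e \<and> transfer_possible H f e b}"

definition externally_inactive ::
    "('v, 'e) pre_hypergraph \<Rightarrow> 'e rel \<Rightarrow> ('e \<Rightarrow> nat) \<Rightarrow> 'e set" where
  "externally_inactive H r f =
     {e \<in> hyperedges H.
        \<exists>b \<in> hyperedges H. (b, e) \<in> r \<and> b \<noteq> e \<and> transfer_possible H f b e}"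

definition interior_polynomial :: "('v, 'e) pre_hypergraph \<Rightarrow> 'e rel \<Rightarrow> int poly" where
  "interior_polynomial H r =
     (\<Sum>f \<in> hypertrees H. monom 1 (card (internally_inactive H r f)))"

definition exterior_polynomial :: "('v, 'e) pre_hypergraph \<Rightarrow> 'e rel \<Rightarrow> int poly" where
  "exterior_polynomial H r =
     (\<Sum>f \<in> hypertrees H. monom 1 (card (externally_inactive H r f)))"

text \<open>The sums range over a finite set.\<close>

lemma finite_hypertrees:
  assumes "hypergraph H"
  shows "finite (hypertrees H)"
proof (rule finite_subset)
  have fin: "finite (vertices H)" "finite (hyperedges H)"
    using assms by (auto simp: hypergraph_def)
  show "finite (hyperedges H \<rightarrow>\<^sub>E {..card (vertices H)})"
    using fin by (intro finite_PiE) auto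
  show "hypertrees H \<subseteq> hyperedges H \<rightarrow>\<^sub>E {..card (vertices H)}"
  proof
    fix f assume "f \<in> hypertrees H"
    then obtain T where f: "f \<in> hyperedges H \<rightarrow>\<^sub>E UNIV"
      and T: "spanning (with_proj T) (with_proj (Bip H))"
      and deg: "\<And>e. e \<in> hyperedges H \<Longrightarrow> out_degree (with_proj T) (Inr e) = f e + 1"
      by (auto simp: hypertrees_def undirected_spanning_tree_def)
    have "f e \<le> card (vertices H)" if e: "e \<in> hyperedges H" for e
    proof -
      have "parcs T \<subseteq> parcs (Bip H)"
        using T by (simp add: spanning_def subgraph_def)
      then have "out_arcs (with_proj T) (Inr e) \<subseteq> (\<lambda>v. (Inr e, Inl v)) ` vertices H"
        by (auto simp: out_arcs_def Bip_def)
      then have "out_degree (with_proj T) (Inr e) \<le> card (vertices H)"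
        unfolding out_degree_def by (rule surj_card_le[OF fin(1)])
      then show ?thesis using deg[OF e] by simp
    qed
    then show "f \<in> hyperedges H \<rightarrow>\<^sub>E {..card (vertices H)}"
      using f by (auto simp: PiE_iff)
  qed
qed

end

theory Submission
  imports Defs
begin

text \<open>
  Spanning trees of the bipartite graph are the bases of its cycle matroid. Moving from one tree
  towards another by basis exchanges, and following the resulting chain of degree changes at the
  hyperedges, shows that the hypertrees form an M-convex set: if \<open>f\<close> exceeds \<open>g\<close> at \<open>x\<close>, one unit can
  be moved in \<open>f\<close> from \<open>x\<close> to some \<open>y\<close> where \<open>f\<close> is below \<open>g\<close>, and dually. Order independence holds
  for every finite M-convex set of integer vectors. Two orders are linked by swaps of adjacent
  elements \<open>a\<close>, \<open>b\<close>. Such a swap changes the count of \<open>f\<close> only if \<open>f\<close> is an end of its segment in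
  direction \<open>a - b\<close> and cannot give from there to a smaller element; the opposite end of the segment
  then has the same defect, all other elements have the same status at both ends, and exchanging the
  two ends compensates the change. External inactivity is internal inactivity of the negated set.
\<close>

section \<open>Basis exchange in the cycle matroid\<close>

text \<open>A graph is given by choosing one orientation of each of its edges.\<close>

definition join :: "'a rel \<Rightarrow> 'a rel" where
  "join R = (R \<union> R\<inverse>)\<^sup>*"

text \<open>Independence in the cycle matroid: no edge lies in the closure of the others. Loops, and
  edges present in both orientations, are thereby excluded.\<close>

definition cycle_free :: "'a rel \<Rightarrow> bool" where
  "cycle_free R \<longleftrightarrow> (\<forall>x\<in>R. x \<notin> join (R - {x}))"

definition basis :: "'a rel \<Rightarrow> 'a rel \<Rightarrow> bool" where
  "basis I T \<longleftrightarrow> T \<subseteq> I \<and> join T = join I \<and> cycle_free T"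

lemma subset_join: "R \<subseteq> join R"
  by (auto simp: join_def)

lemma join_trans: "(x, y) \<in> join R \<Longrightarrow> (y, z) \<in> join R \<Longrightarrow> (x, z) \<in> join R"
  by (auto simp: join_def)

lemma join_sym: "(x, y) \<in> join R \<Longrightarrow> (y, x) \<in> join R"
  unfolding join_def by (meson sym_Un_converse sym_rtrancl symE)

lemma join_subset_iff: "join R \<subseteq> join S \<longleftrightarrow> R \<subseteq> join S"
proof
  assume "R \<subseteq> join S"
  then have "R \<union> R\<inverse> \<subseteq> join S" by (auto intro: join_sym)
  then have "join R \<subseteq> (join S)\<^sup>*"
    unfolding join_def[of R] by (rule rtrancl_mono)
  then show "join R \<subseteq> join S" by (simp add: join_def)
qed (use subset_join in blast)

lemma join_mono: "R \<subseteq> S \<Longrightarrow> join R \<subseteq> join S"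
  using subset_join[of S] by (simp add: join_subset_iff)

text \<open>A path in the enlarged graph can be shortened until it crosses the new edge at most
  once, in one of its two directions.\<close>

lemma join_insertD:
  assumes "(x, y) \<in> join (insert (u, v) R)"
  shows "(x, y) \<in> join R \<or> (x, u) \<in> join R \<and> (v, y) \<in> join R \<or> (x, v) \<in> join R \<and> (u, y) \<in> join R"
  using assms unfolding join_def[of "insert _ _"]
proof (induction rule: rtrancl_induct)
  case base
  show ?case by (simp add: join_def)
next
  case (step y z)
  then consider "(y, z) \<in> join R" | "y = u" "z = v" | "y = v" "z = u"
    using subset_join[of R] by (auto dest: join_sym)
  then show ?case
  proof cases
    case 1
    with step.IH show ?thesis by (blast intro: join_trans)
  next
    case 2
    have "(z, z) \<in> join R" by (simp add: join_def)
    with 2 step.IH show ?thesis by blast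
  next
    case 3
    have "(z, z) \<in> join R" by (simp add: join_def)
    with 3 step.IH show ?thesis by blast
  qed
qed

text \<open>The exchange property of matroid closure. A path between the ends of \<open>e\<close>
  must cross \<open>d\<close>; its two remaining pieces together with \<open>e\<close> join the ends
  of \<open>d\<close>.\<close>

lemma join_exchange:
  assumes "e \<in> join (insert d R)" "e \<notin> join R"
  shows "d \<in> join (insert e R)"
proof -
  obtain x y u v where [simp]: "e = (x, y)" "d = (u, v)" by (metis surj_pair)
  have sub: "join R \<subseteq> join (insert e R)" by (intro join_mono) auto
  have "(x, y) \<in> join (insert e R)" using subset_join[of "insert e R"] by auto
  then show ?thesis
    using join_insertD[of x y u v R] assms sub by (simp) (meson join_sym join_trans subsetD)
qed

lemma cycle_free_mono: "cycle_free R \<Longrightarrow> S \<subseteq> R \<Longrightarrow> cycle_free S"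
  unfolding cycle_free_def by (meson Diff_mono join_mono subset_iff subset_refl)

text \<open>If an old edge \<open>d\<close> became redundant, exchanging it with \<open>e\<close>
  would put \<open>e\<close> in the closure of \<open>R\<close>.\<close>

lemma cycle_free_insert:
  assumes "cycle_free R" "e \<notin> join R"
  shows "cycle_free (insert e R)"
  unfolding cycle_free_def
proof (intro ballI notI)
  fix d assume d: "d \<in> insert e R" "d \<in> join (insert e R - {d})"
  have e: "e \<notin> R" using assms subset_join by blast
  show False
  proof (cases "d = e")
    case True
    with d e assms show False by simp
  next
    case False
    with d have dR: "d \<in> R" and "d \<in> join (insert e (R - {d}))"
      by (auto simp: insert_Diff_if)
    moreover have "d \<notin> join (R - {d})"
      using assms dR by (auto simp: cycle_free_def)
    ultimately have "e \<in> join (insert d (R - {d}))" by (rule_tac join_exchange)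
    with dR assms show False by (simp add: insert_absorb)
  qed
qed

lemma basis_subset_join: "basis I T \<Longrightarrow> basis I T' \<Longrightarrow> T' \<subseteq> join T"
  unfolding basis_def using subset_join by blast

lemma basisI_subset_join:
  assumes "basis I T" "U \<subseteq> I" "T \<subseteq> join U" "cycle_free U"
  shows "basis I U"
  using assms join_mono[of U I] by (metis basis_def join_subset_iff subset_antisym)

text \<open>\<open>T'\<close> spans \<open>e\<close> but \<open>T - {e}\<close> does not, so
  \<open>T'\<close> has an edge outside the closure of \<open>T - {e}\<close>. Any such edge repairs
  \<open>T - {e}\<close>.\<close>

lemma basis_remove_insert:
  assumes T: "basis I T" "basis I T'" and e: "e \<in> T - T'"
  obtains d where "d \<in> T' - T" "basis I (insert d (T - {e}))"
proof -
  have "e \<notin> join (T - {e})" using T(1) e unfolding basis_def cycle_free_def by blast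
  moreover have "e \<in> join T'" using basis_subset_join[OF T(2,1)] e by blast
  ultimately have "\<not> T' \<subseteq> join (T - {e})" by (metis join_subset_iff subsetD)
  then obtain d where d: "d \<in> T'" "d \<notin> join (T - {e})" by blast
  have ins: "insert e (T - {e}) = T" using e by blast
  have "d \<notin> T" using d e subset_join[of "T - {e}"] by blast
  have "d \<in> join (insert e (T - {e}))"
    unfolding ins using basis_subset_join[OF T] d by blast
  then have "e \<in> join (insert d (T - {e}))" using d(2) by (rule join_exchange)
  then have "T \<subseteq> join (insert d (T - {e}))"
    using subset_join[of "insert d (T - {e})"] by blast
  moreover have "insert d (T - {e}) \<subseteq> I" using T d unfolding basis_def by blast
  moreover have "cycle_free (insert d (T - {e}))"
    using T d(2) by (intro cycle_free_insert) (auto simp: basis_def elim: cycle_free_mono)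
  ultimately have "basis I (insert d (T - {e}))"
    using basisI_subset_join[OF T(1)] by blast
  with that d \<open>d \<notin> T\<close> show thesis by blast
qed

text \<open>The dual exchange. A smallest \<open>C\<close> inside \<open>T\<close> spanning
  \<open>e\<close> forms with \<open>e\<close> the fundamental cycle. The cycle-free
  \<open>T'\<close> contains \<open>e\<close>, so it cannot contain all of \<open>C\<close>, and any
  edge of \<open>C - T'\<close> may be dropped.\<close>

lemma basis_insert_remove:
  assumes T: "basis I T" "basis I T'" and fin: "finite T" and e: "e \<in> T' - T"
  obtains d where "d \<in> T - T'" "basis I (insert e (T - {d}))"
proof -
  have "e \<in> join T" using basis_subset_join[OF T] e by blast
  then obtain C where C: "C \<subseteq> T" "e \<in> join C"
    and least: "\<And>D. D \<subseteq> T \<Longrightarrow> e \<in> join D \<Longrightarrow> card C \<le> card D"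
    using ex_has_least_nat[of "\<lambda>C. C \<subseteq> T \<and> e \<in> join C" T card] by blast
  have min: "e \<notin> join D" if "D \<subset> C" for D
    using least[of D] that C psubset_card_mono[OF finite_subset[OF C(1) fin] that] by auto
  have "e \<notin> join (T' - {e})" using T(2) e unfolding basis_def cycle_free_def by blast
  with C e have "\<not> C \<subseteq> T'" using join_mono[of C "T' - {e}"] by blast
  then obtain d where d: "d \<in> C" "d \<notin> T'" by blast
  have "e \<in> join (insert d (C - {d}))" using d C by (simp add: insert_absorb)
  moreover have "e \<notin> join (C - {d})" using min d by blast
  ultimately have "d \<in> join (insert e (C - {d}))" by (rule join_exchange)
  then have dj: "d \<in> join (insert e (T - {d}))"
    using join_mono[of "insert e (C - {d})" "insert e (T - {d})"] C by blast
  \<comment> \<open>Otherwise \<open>d\<close> too would lie in the closure of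
    \<open>T - {d}\<close>, although \<open>T\<close> is cycle-free.\<close>
  have "e \<notin> join (T - {d})"
  proof
    assume "e \<in> join (T - {d})"
    then have "join (insert e (T - {d})) \<subseteq> join (T - {d})"
      using subset_join[of "T - {d}"] by (simp add: join_subset_iff)
    with dj d C T(1) show False unfolding basis_def cycle_free_def by blast
  qed
  then have "cycle_free (insert e (T - {d}))"
    using T by (intro cycle_free_insert) (auto simp: basis_def elim: cycle_free_mono)
  moreover have "T \<subseteq> join (insert e (T - {d}))"
    using dj subset_join[of "insert e (T - {d})"] by blast
  moreover have "insert e (T - {d}) \<subseteq> I" using T e unfolding basis_def by blast
  ultimately have "basis I (insert e (T - {d}))"
    using basisI_subset_join[OF T(1)] by blast
  with that d C show thesis by blast
qed

section \<open>Exchange of degrees\<close>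

definition degree_at :: "('b \<times> 'a) set \<Rightarrow> 'a \<Rightarrow> int" where
  "degree_at T x = int (card {p \<in> T. snd p = x})"

definition move :: "('a \<Rightarrow> int) \<Rightarrow> 'a \<Rightarrow> 'a \<Rightarrow> 'a \<Rightarrow> int" where
  "move f a b = f(a := f a - 1, b := f b + 1)"

lemma degree_at_insert:
  assumes "finite T" "e \<notin> T"
  shows "degree_at (insert e T) = (degree_at T)(snd e := degree_at T (snd e) + 1)"
proof
  fix x
  have "{p \<in> insert e T. snd p = x} = (if snd e = x then insert e {p \<in> T. snd p = x} else {p \<in> T. snd p = x})"
    by auto
  then show "degree_at (insert e T) x = ((degree_at T)(snd e := degree_at T (snd e) + 1)) x"
    using assms by (simp add: degree_at_def)
qed

lemma degree_at_exchange:
  assumes "finite T" "e \<in> T" "d \<notin> T"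
  shows "degree_at (insert d (T - {e})) =
    (if snd d = snd e then degree_at T else move (degree_at T) (snd e) (snd d))"
proof -
  have "degree_at T = degree_at (insert e (T - {e}))" using assms by (simp add: insert_absorb)
  also have "\<dots> = (degree_at (T - {e}))(snd e := degree_at (T - {e}) (snd e) + 1)"
    using assms by (intro degree_at_insert) auto
  finally show ?thesis
    using degree_at_insert[of "T - {e}" d] assms by (auto simp: move_def fun_eq_iff)
qed

lemma degree_at_lessD:
  assumes "finite T'" "degree_at T' x < degree_at T x"
  obtains e where "e \<in> T - T'" "snd e = x"
proof -
  have "\<not> {p \<in> T. snd p = x} \<subseteq> {p \<in> T'. snd p = x}"
    using assms card_mono[of "{p \<in> T'. snd p = x}" "{p \<in> T. snd p = x}"]
    by (auto simp: degree_at_def)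
  then show thesis using that by blast
qed

text \<open>Induction on the distance to \<open>T'\<close>. An edge at \<open>x\<close> is exchanged
  for an edge of \<open>T'\<close> at some \<open>?y\<close>. If \<open>?y\<close> is
  \<open>x\<close>, no degree has changed and the tree is closer to \<open>T'\<close>; if
  \<open>?y\<close> was below its target, the move is found. Otherwise \<open>?y\<close> now exceeds
  its target, and the induction hypothesis passes the surplus unit on.\<close>

lemma degree_exchange_down:
  assumes "finite I" "basis I T" "basis I T'" "degree_at T' x < degree_at T x"
  shows "\<exists>y U. degree_at T y < degree_at T' y \<and> basis I U \<and> degree_at U = move (degree_at T) x y"
  using assms(2,4)
proof (induction "card (T - T')" arbitrary: T x rule: less_induct)
  case less
  have fin: "finite T" "finite T'"
    using assms less.prems by (auto simp: basis_def intro: finite_subset)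
  obtain e where e: "e \<in> T - T'" "snd e = x"
    by (rule degree_at_lessD[OF fin(2) less.prems(2)])
  obtain d where d: "d \<in> T' - T" and U: "basis I (insert d (T - {e}))" (is "basis I ?U")
    by (rule basis_remove_insert[OF less.prems(1) assms(3) e(1)])
  have "?U - T' = (T - T') - {e}" using d e by auto
  then have IH: "card (?U - T') < card (T - T')"
    using fin e(1) by (metis card_Diff1_less finite_Diff)
  let ?y = "snd d"
  have deg: "degree_at ?U = (if ?y = x then degree_at T else move (degree_at T) x ?y)"
    using degree_at_exchange[of T e d] fin e d by simp
  consider "?y = x" | "?y \<noteq> x" "degree_at T ?y < degree_at T' ?y"
    | "?y \<noteq> x" "degree_at T' ?y \<le> degree_at T ?y" by linarith
  then show ?case
  proof cases
    case 1
    then show ?thesis using less.hyps[OF IH U] deg less.prems by simp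
  next
    case 2
    then show ?thesis using deg U by auto
  next
    case 3
    then have "degree_at T' ?y < degree_at ?U ?y" using deg by (simp add: move_def)
    then obtain z W where z: "degree_at ?U z < degree_at T' z"
      and W: "basis I W" "degree_at W = move (degree_at ?U) ?y z"
      using less.hyps[OF IH U] by blast
    \<comment> \<open>Neither end of the first move is below its target in \<open>?U\<close>:
      \<open>x\<close> has lost one unit of a strict excess, and \<open>?y\<close> has gained one.
      So the moves compose to a single move from \<open>x\<close> to \<open>z\<close>.\<close>
    have "z \<noteq> ?y" "z \<noteq> x" using z 3 deg less.prems by (auto simp: move_def)
    then have "degree_at T z < degree_at T' z" "degree_at W = move (degree_at T) x z"
      using z W 3 deg by (auto simp: move_def fun_eq_iff)
    then show ?thesis using W by blast
  qed
qed

text \<open>The same chain argument read backwards: an edge of \<open>T'\<close> is inserted at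
  \<open>x\<close>, and a deficit created at \<open>?y\<close> is passed on.\<close>

lemma degree_exchange_up:
  assumes "finite I" "basis I T" "basis I T'" "degree_at T x < degree_at T' x"
  shows "\<exists>y U. degree_at T' y < degree_at T y \<and> basis I U \<and> degree_at U = move (degree_at T) y x"
  using assms(2,4)
proof (induction "card (T - T')" arbitrary: T x rule: less_induct)
  case less
  have fin: "finite T" "finite T'"
    using assms less.prems by (auto simp: basis_def intro: finite_subset)
  obtain e where e: "e \<in> T' - T" "snd e = x"
    by (rule degree_at_lessD[OF fin(1) less.prems(2)])
  obtain d where d: "d \<in> T - T'" and U: "basis I (insert e (T - {d}))" (is "basis I ?U")
    by (rule basis_insert_remove[OF less.prems(1) assms(3) fin(1) e(1)])
  have "?U - T' = (T - T') - {d}" using d e by auto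
  then have IH: "card (?U - T') < card (T - T')"
    using fin d by (metis card_Diff1_less finite_Diff)
  let ?y = "snd d"
  have deg: "degree_at ?U = (if ?y = x then degree_at T else move (degree_at T) ?y x)"
    using degree_at_exchange[of T d e] fin e d by simp
  consider "?y = x" | "?y \<noteq> x" "degree_at T' ?y < degree_at T ?y"
    | "?y \<noteq> x" "degree_at T ?y \<le> degree_at T' ?y" by linarith
  then show ?case
  proof cases
    case 1
    then show ?thesis using less.hyps[OF IH U] deg less.prems by simp
  next
    case 2
    then show ?thesis using deg U by auto
  next
    case 3
    then have "degree_at ?U ?y < degree_at T' ?y" using deg by (simp add: move_def)
    then obtain z W where z: "degree_at T' z < degree_at ?U z"
      and W: "basis I W" "degree_at W = move (degree_at ?U) z ?y"
      using less.hyps[OF IH U] by blast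
    have "z \<noteq> ?y" "z \<noteq> x" using z 3 deg less.prems by (auto simp: move_def)
    then have "degree_at T' z < degree_at T z" "degree_at W = move (degree_at T) z x"
      using z W 3 deg by (auto simp: move_def fun_eq_iff)
    then show ?thesis using W by blast
  qed
qed

section \<open>Order independence for M-convex sets\<close>

text \<open>Both one-sided exchange axioms are included, which makes the notion invariant under
  negation. In each clause the inequalities force \<open>y\<close> to differ from
  \<open>x\<close>.\<close>

definition M_convex :: "('a \<Rightarrow> int) set \<Rightarrow> bool" where
  "M_convex B \<longleftrightarrow>
     (\<forall>f\<in>B. \<forall>g\<in>B. \<forall>x. g x < f x \<longrightarrow> (\<exists>y. f y < g y \<and> move f x y \<in> B)) \<and>
     (\<forall>f\<in>B. \<forall>g\<in>B. \<forall>x. f x < g x \<longrightarrow> (\<exists>y. g y < f y \<and> move f y x \<in> B))"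

definition can_give :: "('a \<Rightarrow> int) set \<Rightarrow> ('a \<Rightarrow> int) \<Rightarrow> 'a set \<Rightarrow> 'a \<Rightarrow> bool" where
  "can_give B f D e \<longleftrightarrow> (\<exists>y\<in>D. move f e y \<in> B)"

text \<open>The list is in increasing order; \<open>D\<close> collects the elements that precede it.\<close>

fun inactivity :: "('a \<Rightarrow> int) set \<Rightarrow> ('a \<Rightarrow> int) \<Rightarrow> 'a set \<Rightarrow> 'a list \<Rightarrow> nat" where
  "inactivity B f D [] = 0"
| "inactivity B f D (e # es) = of_bool (can_give B f D e) + inactivity B f (insert e D) es"

definition inactivity_poly :: "('a \<Rightarrow> int) set \<Rightarrow> 'a list \<Rightarrow> int poly" where
  "inactivity_poly B es = (\<Sum>f\<in>B. monom 1 (inactivity B f {} es))"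

lemma M_convexD_down:
  "M_convex B \<Longrightarrow> f \<in> B \<Longrightarrow> g \<in> B \<Longrightarrow> g x < f x \<Longrightarrow> \<exists>y. f y < g y \<and> move f x y \<in> B"
  by (auto simp: M_convex_def)

lemma M_convexD_up:
  "M_convex B \<Longrightarrow> f \<in> B \<Longrightarrow> g \<in> B \<Longrightarrow> f x < g x \<Longrightarrow> \<exists>y. g y < f y \<and> move f y x \<in> B"
  by (auto simp: M_convex_def)

lemma inactivity_append:
  "inactivity B f D (xs @ ys) = inactivity B f D xs + inactivity B f (D \<union> set xs) ys"
  by (induction xs arbitrary: D) auto

lemma inactivity_cong:
  assumes "\<And>ys e zs. xs = ys @ e # zs \<Longrightarrow>
    can_give B f (D \<union> set ys) e \<longleftrightarrow> can_give B g (D \<union> set ys) e"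
  shows "inactivity B f D xs = inactivity B g D xs"
  using assms
proof (induction xs arbitrary: D)
  case (Cons x xs)
  have "can_give B f (insert x D \<union> set ys) e \<longleftrightarrow> can_give B g (insert x D \<union> set ys) e"
    if "xs = ys @ e # zs" for ys e zs
    using Cons.prems[of "x # ys" e zs] that by simp
  then have "inactivity B f (insert x D) xs = inactivity B g (insert x D) xs"
    by (rule Cons.IH)
  then show ?case using Cons.prems[of "[]" x xs] by simp
qed simp

text \<open>At \<open>b\<close> the vector \<open>move f a s\<close> exceeds
  \<open>move f b a\<close>, and \<open>a\<close> is the only place where it is smaller. Exchange
  therefore moves a unit from \<open>b\<close> to \<open>a\<close>, and the two visits to
  \<open>a\<close> cancel.\<close>

lemma move_trans:
  assumes "M_convex B" "move f b a \<in> B" "move f a s \<in> B" "a \<noteq> b" "s \<noteq> a" "s \<noteq> b"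
  shows "move f b s \<in> B"
proof -
  have "move f b a b < move f a s b" using assms(4-) by (simp add: move_def)
  then obtain y where y: "move f a s y < move f b a y" "move (move f a s) b y \<in> B"
    using M_convexD_down assms(1-3) by metis
  then have "y = a" using assms(4-) by (auto simp: move_def split: if_splits)
  moreover have "move (move f a s) b a = move f b s"
    using assms(4-) by (auto simp: move_def)
  ultimately show ?thesis using y by simp
qed

section \<open>Segments in direction \<open>a - b\<close> and the exchange of their ends\<close>

definition slide :: "'a \<Rightarrow> 'a \<Rightarrow> ('a \<Rightarrow> int) \<Rightarrow> int \<Rightarrow> 'a \<Rightarrow> int" where
  "slide a b f k = f(a := f a + k, b := f b - k)"

lemma slide_inject: "a \<noteq> b \<Longrightarrow> slide a b f k = slide a b f l \<longleftrightarrow> k = l"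
  by (auto simp: slide_def dest: fun_cong[of _ _ a])

text \<open>
  If the elements smaller than \<open>a\<close> and \<open>b\<close> form \<open>S\<close>, then \<open>critical B S a b\<close> and \<open>critical B S b a\<close>
  together contain exactly the vectors whose inactivity count changes when \<open>a\<close> and \<open>b\<close> trade places.
\<close>

definition critical :: "('a \<Rightarrow> int) set \<Rightarrow> 'a set \<Rightarrow> 'a \<Rightarrow> 'a \<Rightarrow> ('a \<Rightarrow> int) set" where
  "critical B S a b = {f \<in> B. move f b a \<in> B \<and> move f a b \<notin> B \<and> \<not> can_give B f S b}"

text \<open>Only the coordinate \<open>a\<close> is larger at the far point, so exchange at
  \<open>b\<close> must feed \<open>a\<close>. Hence a line in this direction meets \<open>B\<close>
  without gaps.\<close>

lemma slide_interval:
  assumes "M_convex B" "a \<noteq> b" "f \<in> B" "slide a b f k \<in> B" "0 < k"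
  shows "move f b a \<in> B"
proof -
  have "slide a b f k b < f b" using assms by (simp add: slide_def)
  then obtain y where "f y < slide a b f k y" "move f b y \<in> B"
    using M_convexD_down assms by metis
  moreover from this have "y = a" using assms by (auto simp: slide_def split: if_splits)
  ultimately show ?thesis by simp
qed

text \<open>The vector sought is the other end of the segment through \<open>f\<close>, reached by
  the largest shift \<open>k\<close> that stays in \<open>B\<close>.\<close>

lemma slide_critical:
  assumes M: "M_convex B" and fin: "finite B" and ab: "a \<noteq> b" "a \<notin> S" "b \<notin> S"
    and f: "f \<in> critical B S a b"
  shows "\<exists>k>0. slide a b f k \<in> critical B S b a"
proof -
  have fB: "f \<in> B" "move f b a \<in> B" "\<not> can_give B f S b"
    using f by (auto simp: critical_def)
  define K where "K = {k. slide a b f k \<in> B}"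
  have "inj_on (slide a b f) K" using slide_inject[OF ab(1)] by (auto intro: inj_onI)
  then have "finite K" using fin by (rule_tac finite_imageD) (auto simp: K_def intro: finite_subset)
  have "slide a b f 1 = move f b a" using ab by (auto simp: slide_def move_def)
  then have 1: "1 \<in> K" using fB by (simp add: K_def)
  define k where "k = Max K"
  have k: "k \<in> K" "1 \<le> k" using Max_in[OF \<open>finite K\<close>] Max_ge[OF \<open>finite K\<close> 1] 1 by (auto simp: k_def)
  define g where "g = slide a b f k"
  have gB: "g \<in> B" using k by (simp add: g_def K_def)
  have "slide a b f (k + 1) \<notin> B" using Max_ge[OF \<open>finite K\<close>, of "k + 1"] by (auto simp: k_def K_def)
  moreover have "slide a b f (k + 1) = move g b a"
    using ab by (auto simp: slide_def move_def g_def)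
  ultimately have 2: "move g b a \<notin> B" by simp
  have "slide b a g k = f" using ab by (auto simp: slide_def g_def)
  then have 3: "move g a b \<in> B" using slide_interval[of B b a g k] M ab gB fB k by simp
  \<comment> \<open>If \<open>g\<close> could give from \<open>a\<close> to \<open>s\<close>,
    comparing \<open>f\<close> with the result at \<open>s\<close> would yield a donor for
    \<open>s\<close> in \<open>f\<close>. Only \<open>b\<close> qualifies, since \<open>k\<close> is
    at least 1, but \<open>f\<close> cannot give from \<open>b\<close> to \<open>S\<close>.\<close>
  have "\<not> can_give B g S a"
  proof
    assume "can_give B g S a"
    then obtain s where s: "s \<in> S" "move g a s \<in> B" by (auto simp: can_give_def)
    with ab have sab: "s \<noteq> a" "s \<noteq> b" by auto
    then have "f s < move g a s s" by (simp add: move_def g_def slide_def)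
    then obtain y where y: "move g a s y < f y" "move f y s \<in> B"
      using M_convexD_up M fB(1) s(2) by metis
    then have "y = b"
      using sab ab k by (auto simp: move_def g_def slide_def split: if_splits)
    with y s fB show False by (auto simp: can_give_def)
  qed
  with 2 3 gB k show ?thesis
    by (intro exI[of _ k]) (auto simp: critical_def g_def)
qed

text \<open>Exchange at \<open>e\<close> between \<open>g\<close> and \<open>move f e y\<close> can
  only feed \<open>y\<close>, \<open>a\<close> or \<open>b\<close>, and all three lie in
  \<open>D\<close>.\<close>

lemma can_give_after:
  assumes M: "M_convex B" and "f \<in> B" "g \<in> B" and eq: "\<And>x. x \<noteq> a \<Longrightarrow> x \<noteq> b \<Longrightarrow> f x = g x"
    and D: "a \<in> D" "b \<in> D" "e \<notin> D" and give: "can_give B f D e"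
  shows "can_give B g D e"
proof -
  obtain y where y: "y \<in> D" "move f e y \<in> B" using give by (auto simp: can_give_def)
  have e: "e \<noteq> a" "e \<noteq> b" "e \<noteq> y" using D y by auto
  then have "move f e y e < g e" using eq[of e] by (simp add: move_def)
  then obtain z where z: "g z < move f e y z" "move g e z \<in> B"
    using M_convexD_down M assms(3) y(2) by metis
  then have "z = y \<or> z = a \<or> z = b"
    using eq[of z] by (auto simp: move_def split: if_splits)
  with z y D show ?thesis by (auto simp: can_give_def)
qed

text \<open>Here the exchange is made at the receiver \<open>y\<close>. Possible donors are
  \<open>e\<close>, \<open>a\<close> and \<open>b\<close>; \<open>b\<close> is excluded by
  \<open>g b < f b\<close>, and \<open>a\<close> because \<open>g\<close> cannot give from
  \<open>a\<close> to \<open>S\<close>.\<close>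

lemma can_give_before:
  assumes M: "M_convex B" and "f \<in> B" "g \<in> B" and eq: "\<And>x. x \<noteq> a \<Longrightarrow> x \<noteq> b \<Longrightarrow> f x = g x"
    and "g b < f b" and a: "\<not> can_give B g S a"
    and D: "D \<subseteq> S" "a \<notin> S" "b \<notin> S" "e \<in> S" "e \<notin> D" and give: "can_give B f D e"
  shows "can_give B g D e"
proof -
  obtain y where y: "y \<in> D" "move f e y \<in> B" using give by (auto simp: can_give_def)
  have e: "e \<noteq> a" "e \<noteq> b" "e \<noteq> y" "y \<noteq> a" "y \<noteq> b" using D y by auto
  then have "g y < move f e y y" using eq[of y] by (simp add: move_def)
  then obtain z where z: "move f e y z < g z" "move g z y \<in> B"
    using M_convexD_up M assms(3) y(2) by metis
  moreover have "z \<noteq> b" using z(1) assms(5) e by (auto simp: move_def)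
  ultimately have "z = e \<or> z = a"
    using eq[of z] by (auto simp: move_def split: if_splits)
  with z y a D show ?thesis by (auto simp: can_give_def)
qed

text \<open>The two ends agree on the status of every element other than \<open>a\<close> and
  \<open>b\<close>. Both comparison lemmas are applied in each direction, the roles of
  \<open>a\<close> and \<open>b\<close> being exchanged in the backward use of
  \<open>can_give_before\<close>.\<close>

lemma inactivity_critical:
  assumes M: "M_convex B" and dist: "distinct (xs @ a # b # ys)"
    and f: "f \<in> critical B (set xs) a b" and k: "0 < k"
    and g: "slide a b f k \<in> critical B (set xs) b a" (is "?g \<in> _")
  shows "inactivity B f {} xs = inactivity B ?g {} xs"
    and "inactivity B f (insert a (insert b (set xs))) ys =
         inactivity B ?g (insert a (insert b (set xs))) ys"
proof -
  have eq: "\<And>x. x \<noteq> a \<Longrightarrow> x \<noteq> b \<Longrightarrow> f x = ?g x" by (simp add: slide_def)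
  have lt: "?g b < f b" "f a < ?g a" using k dist by (auto simp: slide_def)
  have fg: "f \<in> B" "?g \<in> B" "\<not> can_give B f (set xs) b" "\<not> can_give B ?g (set xs) a"
    using f g by (auto simp: critical_def)
  show "inactivity B f {} xs = inactivity B ?g {} xs"
  proof (rule inactivity_cong)
    fix us e vs assume xs: "xs = us @ e # vs"
    have D: "set us \<subseteq> set xs" "a \<notin> set xs" "b \<notin> set xs" "e \<in> set xs" "e \<notin> set us"
      using xs dist by auto
    show "can_give B f ({} \<union> set us) e = can_give B ?g ({} \<union> set us) e"
      using can_give_before[OF M fg(1,2) eq lt(1) fg(4) D]
        can_give_before[OF M fg(2,1) eq[symmetric] lt(2) fg(3) D(1,3,2,4,5)] by auto
  qed
  show "inactivity B f (insert a (insert b (set xs))) ys =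
         inactivity B ?g (insert a (insert b (set xs))) ys"
  proof (rule inactivity_cong)
    fix us e vs assume ys: "ys = us @ e # vs"
    let ?D = "insert a (insert b (set xs)) \<union> set us"
    have D: "a \<in> ?D" "b \<in> ?D" "e \<notin> ?D" using ys dist by auto
    show "can_give B f ?D e = can_give B ?g ?D e"
      using can_give_after[OF M fg(1,2) eq D] can_give_after[OF M fg(2,1) eq[symmetric] D] by blast
  qed
qed

text \<open>Of two distinct points of \<open>B\<close> on the line, the earlier one can still move
  towards the later, so only the last point is blocked.\<close>

lemma slide_unique:
  assumes "M_convex B" "a \<noteq> b" "slide a b f k \<in> B" "slide a b f l \<in> B"
    "move (slide a b f k) b a \<notin> B" "move (slide a b f l) b a \<notin> B"
  shows "k = l"
proof -
  have *: "slide a b (slide a b f m) (n - m) = slide a b f n" for m n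
    using assms(2) by (auto simp: slide_def)
  have "\<not> k < l" using slide_interval[OF assms(1,2,3), of "l - k"] assms * by auto
  moreover have "\<not> l < k" using slide_interval[OF assms(1,2,4), of "k - l"] assms * by auto
  ultimately show ?thesis by simp
qed

text \<open>Each end determines its segment, and each segment has one end on either side. This gives
  injectivity; surjectivity comes from sliding back with \<open>a\<close> and \<open>b\<close>
  exchanged.\<close>

lemma critical_bij:
  assumes M: "M_convex B" and fin: "finite B" and ab: "a \<noteq> b" "a \<notin> S" "b \<notin> S"
  obtains \<sigma> where "bij_betw \<sigma> (critical B S a b) (critical B S b a)"
    "\<And>f. f \<in> critical B S a b \<Longrightarrow> \<exists>k>0. \<sigma> f = slide a b f k"
proof -
  have "\<forall>f\<in>critical B S a b. \<exists>g. g \<in> critical B S b a \<and> (\<exists>k>0. g = slide a b f k)"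
    using slide_critical[OF assms] by blast
  then obtain \<sigma> where \<sigma>: "\<And>f. f \<in> critical B S a b \<Longrightarrow> \<sigma> f \<in> critical B S b a"
    "\<And>f. f \<in> critical B S a b \<Longrightarrow> \<exists>k>0. \<sigma> f = slide a b f k" by metis
  have inv: "slide b a (slide a b f k) k = f" for f k using ab by (auto simp: slide_def)
  have inv': "slide a b (slide b a f k) k = f" for f k using ab by (auto simp: slide_def)
  have "inj_on \<sigma> (critical B S a b)"
  proof (rule inj_onI)
    fix f f' assume A: "f \<in> critical B S a b" "f' \<in> critical B S a b" "\<sigma> f = \<sigma> f'"
    define h where "h = \<sigma> f"
    have h: "h \<in> critical B S b a" using \<sigma>(1)[OF A(1)] by (simp add: h_def)
    obtain k l where "h = slide a b f k" "h = slide a b f' l" using \<sigma>(2) A h_def by metis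
    then have f: "slide b a h k = f" and f': "slide b a h l = f'" using inv by metis+
    have "f \<in> B" "f' \<in> B" "move f a b \<notin> B" "move f' a b \<notin> B"
      using A(1,2) by (simp_all add: critical_def)
    then have "k = l" by (intro slide_unique[OF M ab(1)[symmetric], of h]) (simp_all add: f f')
    with f f' show "f = f'" by simp
  qed
  moreover have "g \<in> \<sigma> ` critical B S a b" if g: "g \<in> critical B S b a" for g
  proof -
    obtain k where k: "slide b a g k \<in> critical B S a b"
      using slide_critical[OF M fin ab(1)[symmetric] ab(3,2) g] by blast
    define f where "f = slide b a g k"
    have f: "f \<in> critical B S a b" using k by (simp add: f_def)
    obtain l where l: "\<sigma> f = slide a b f l" using \<sigma>(2)[OF f] by blast
    have g': "slide a b f k = g" using inv' by (simp add: f_def)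
    have "slide a b f l \<in> critical B S b a" using \<sigma>(1)[OF f] l by simp
    then have "slide a b f l \<in> B" "g \<in> B" "move (slide a b f l) b a \<notin> B" "move g b a \<notin> B"
      using g by (simp_all add: critical_def)
    then have "k = l" by (intro slide_unique[OF M ab(1), of f]) (simp_all add: g')
    then show ?thesis using f l g' by (metis image_eqI)
  qed
  ultimately have "bij_betw \<sigma> (critical B S a b) (critical B S b a)"
    using \<sigma>(1) by (auto simp: bij_betw_def)
  with \<sigma>(2) that show thesis by blast
qed

lemma inactivity_poly_swap:
  assumes M: "M_convex B" and fin: "finite B" and dist: "distinct (xs @ a # b # ys)"
  shows "inactivity_poly B (xs @ a # b # ys) = inactivity_poly B (xs @ b # a # ys)"
proof -
  define S where "S = set xs"
  have ab: "a \<noteq> b" "a \<notin> S" "b \<notin> S" using dist by (auto simp: S_def)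
  \<comment> \<open>\<open>c\<close> is the contribution of \<open>xs\<close> and \<open>ys\<close>,
    unaffected by the order of \<open>a\<close> and \<open>b\<close>; \<open>w\<close> is the full
    count.\<close>
  define c where "c f = inactivity B f {} xs + inactivity B f (insert a (insert b S)) ys" for f
  define w where "w a b f = of_bool (can_give B f S a) + of_bool (can_give B f (insert a S) b) + c f"
    for a b f
  let ?P = "critical B S a b" and ?Q = "critical B S b a"
  have w: "inactivity B f {} (xs @ a # b # ys) = w a b f"
    "inactivity B f {} (xs @ b # a # ys) = w b a f" for f
    by (simp_all add: inactivity_append w_def c_def S_def insert_commute)
  have ins: "can_give B f (insert x S) y \<longleftrightarrow> move f y x \<in> B \<or> can_give B f S y" for f x y
    by (auto simp: can_give_def)
  \<comment> \<open>A unit given by \<open>y\<close> to \<open>x\<close> and then by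
    \<open>x\<close> to \<open>S\<close> can go directly, by \<open>move_trans\<close>. This settles
    all cases in which both or neither of the two orders sees an extra inactive element.\<close>
  have tr: "can_give B f S y" if "can_give B f S x" "move f y x \<in> B" "{x, y} = {a, b}" for f x y
  proof -
    have "x \<noteq> y" "x \<notin> S" "y \<notin> S" using ab that(3) by (auto simp: doubleton_eq_iff)
    then show ?thesis using that M move_trans[of B f y x] unfolding can_give_def by metis
  qed
  have tr1: "can_give B f S a \<Longrightarrow> move f b a \<in> B \<Longrightarrow> can_give B f S b"
    and tr2: "can_give B f S b \<Longrightarrow> move f a b \<in> B \<Longrightarrow> can_give B f S a" for f
    by (auto intro: tr)
  have P: "w a b f = Suc (c f)" "w b a f = c f" if "f \<in> ?P" for f
    using that tr1[of f] by (auto simp: critical_def w_def ins)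
  have Q: "w a b f = c f" "w b a f = Suc (c f)" if "f \<in> ?Q" for f
    using that tr2[of f] by (auto simp: critical_def w_def ins)
  have R: "w a b f = w b a f" if "f \<in> B - (?P \<union> ?Q)" for f
    using that tr1[of f] tr2[of f] by (auto simp: critical_def w_def ins)
  obtain \<sigma> where \<sigma>: "bij_betw \<sigma> ?P ?Q" "\<And>f. f \<in> ?P \<Longrightarrow> \<exists>k>0. \<sigma> f = slide a b f k"
    using critical_bij[OF M fin ab] by blast
  have c: "c (\<sigma> f) = c f" if f: "f \<in> ?P" for f
  proof -
    obtain k where k: "0 < k" "\<sigma> f = slide a b f k" using \<sigma>(2) f by blast
    have "\<sigma> f \<in> ?Q" using \<sigma>(1) f by (auto simp: bij_betw_def)
    then show ?thesis
      using inactivity_critical[OF M dist, of f k] f k by (simp add: c_def S_def)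
  qed
  have split: "sum h B = sum h (B - (?P \<union> ?Q)) + (sum h ?P + sum h ?Q)" for h :: "_ \<Rightarrow> int poly"
  proof -
    have sub: "?P \<union> ?Q \<subseteq> B" and disj: "?P \<inter> ?Q = {}" by (auto simp: critical_def)
    have "finite ?P" "finite ?Q" using sub fin by (auto intro: finite_subset)
    then show ?thesis using sum.subset_diff[OF sub fin, of h] sum.union_disjoint[OF _ _ disj, of h]
      by simp
  qed
  \<comment> \<open>Used with \<open>Suc\<close> and with \<open>id\<close>: the swap lowers the
    count by one on \<open>?P\<close> and raises it by one on \<open>?Q\<close>, and
    \<open>\<sigma>\<close> matches the terms.\<close>
  have PQ: "(\<Sum>f\<in>?Q. monom (1::int) (h (c f))) = (\<Sum>f\<in>?P. monom 1 (h (c f)))" for h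
    using sum.reindex_bij_betw[OF \<sigma>(1), of "\<lambda>f. monom (1::int) (h (c f))"] c by simp
  show ?thesis
    unfolding inactivity_poly_def w split
    using PQ[of Suc] PQ[of id] P Q R by simp
qed

text \<open>The common prefix \<open>zs\<close> is generalised. The head of one list is carried to
  the front of the other by adjacent swaps, then joins the prefix.\<close>

lemma inactivity_poly_permute:
  assumes M: "M_convex B" and fin: "finite B" and "distinct xs" "distinct ys" "set xs = set ys"
  shows "inactivity_poly B xs = inactivity_poly B ys"
proof -
  have "inactivity_poly B (zs @ xs) = inactivity_poly B (zs @ ys)"
    if "distinct (zs @ xs)" "distinct (zs @ ys)" "set xs = set ys" for zs
    using that
  proof (induction xs arbitrary: zs ys)
    case (Cons x xs)
    then obtain us vs where ys: "ys = us @ x # vs" by (metis in_set_conv_decomp list.set_intros(1))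
    have "inactivity_poly B (zs @ us @ x # vs) = inactivity_poly B (zs @ x # us @ vs)"
      using Cons.prems(2)[unfolded ys]
    proof (induction us arbitrary: vs rule: rev_induct)
      case (snoc u us)
      then show ?case
        using inactivity_poly_swap[OF M fin, of "zs @ us" u x vs] snoc.IH[of "u # vs"] by auto
    qed simp
    also have "set xs = set (us @ vs)" using Cons.prems unfolding ys by auto
    then have "inactivity_poly B (zs @ x # us @ vs) = inactivity_poly B (zs @ x # xs)"
      using Cons.IH[of "zs @ [x]" "us @ vs"] Cons.prems ys by auto
    finally show ?case using ys by simp
  qed simp
  from this[of "[]"] assms show ?thesis by simp
qed

section \<open>From linear orders to increasing lists\<close>

definition sorted_list :: "'a set \<Rightarrow> 'a rel \<Rightarrow> 'a list \<Rightarrow> bool" where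
  "sorted_list A r xs \<longleftrightarrow> distinct xs \<and> set xs = A \<and> sorted_wrt (\<lambda>x y. (x, y) \<in> r) xs"

lemma sorted_list_exists:
  assumes "finite A" "linear_order_on A r"
  shows "\<exists>xs. sorted_list A r xs"
proof -
  have tot: "trans r" "total_on A r" "refl_on A r" using assms(2) by (auto simp: order_on_defs)
  have "\<exists>xs. sorted_list C r xs" if "C \<subseteq> A" for C
    using finite_subset[OF that assms(1)] that
  proof (induction C rule: finite_induct)
    case (insert x C)
    then obtain xs where xs: "sorted_list C r xs" by auto
    let ?l = "[y\<leftarrow>xs. (y, x) \<in> r]" and ?u = "[y\<leftarrow>xs. (y, x) \<notin> r]"
    have xu: "(x, y) \<in> r" if "y \<in> C" "(y, x) \<notin> r" for y
      using tot(2)[unfolded total_on_def, rule_format, of x y] insert.hyps(2) insert.prems that by blast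
    have "(y, z) \<in> r" if "y \<in> set ?l" "z \<in> set ?u" for y z
      using that xs xu[of z] transD[OF tot(1), of y x z] by (simp add: sorted_list_def)
    then have "\<forall>y\<in>set ?l. \<forall>z\<in>set (x # ?u). (y, z) \<in> r" by simp
    moreover have "\<forall>z\<in>set ?u. (x, z) \<in> r" using xs xu by (simp add: sorted_list_def)
    moreover have "sorted_wrt (\<lambda>x y. (x, y) \<in> r) xs" using xs by (simp add: sorted_list_def)
    ultimately have "sorted_wrt (\<lambda>x y. (x, y) \<in> r) (?l @ x # ?u)"
      unfolding sorted_wrt_append sorted_wrt.simps by (blast intro: sorted_wrt_filter)
    then have "sorted_list (insert x C) r (?l @ x # ?u)"
      using xs insert by (auto simp: sorted_list_def)
    then show ?case ..
  next
    case empty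
    have "sorted_list {} r []" by (simp add: sorted_list_def)
    then show ?case ..
  qed
  then show ?thesis by blast
qed

text \<open>Induction from the right: the last element is the largest, so by antisymmetry it cannot
  serve as a smaller receiver for the others.\<close>

lemma inactivity_sorted_list:
  assumes "antisym r" "sorted_list A r xs"
  shows "inactivity B f {} xs = card {e \<in> A. \<exists>b\<in>A. (b, e) \<in> r \<and> b \<noteq> e \<and> move f e b \<in> B}"
  using assms(2)
proof (induction xs arbitrary: A rule: rev_induct)
  case Nil
  then show ?case by (simp add: sorted_list_def)
next
  case (snoc x xs)
  let ?I = "\<lambda>A. {e \<in> A. \<exists>b\<in>A. (b, e) \<in> r \<and> b \<noteq> e \<and> move f e b \<in> B}"
  have xs: "sorted_list (set xs) r xs" "x \<notin> set xs" "A = insert x (set xs)"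
    and le: "\<And>y. y \<in> set xs \<Longrightarrow> (y, x) \<in> r"
    using snoc.prems by (auto simp: sorted_list_def sorted_wrt_append)
  have "\<And>y. y \<in> set xs \<Longrightarrow> (x, y) \<notin> r" using le xs(2) assms(1) by (metis antisymD)
  then have "?I A = ?I (set xs) \<union> (if can_give B f (set xs) x then {x} else {})"
    using xs le by (auto simp: can_give_def)
  moreover have "x \<notin> ?I (set xs)" using xs by simp
  ultimately have "card (?I A) = card (?I (set xs)) + of_bool (can_give B f (set xs) x)"
    by simp
  then show ?case using snoc.IH[OF xs(1)] by (simp add: inactivity_append)
qed

text \<open>Negation reverses every move, hence interchanges the two clauses of the
  definition.\<close>

lemma M_convex_uminus:
  assumes "M_convex B"
  shows "M_convex ((\<lambda>f x. - f x) ` B)"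
proof -
  have neg: "move (\<lambda>x. - f x) x y = (\<lambda>z. - move f y x z)" if "x \<noteq> y" for f :: "'a \<Rightarrow> int" and x y
    using that by (auto simp: move_def)
  have "\<exists>y. - f y < - g y \<and> move (\<lambda>x. - f x) x y \<in> (\<lambda>f x. - f x) ` B"
    if "f \<in> B" "g \<in> B" "f x < g x" for f g x
    using M_convexD_up[OF assms that] that neg[of x] by force
  moreover have "\<exists>y. - g y < - f y \<and> move (\<lambda>x. - f x) y x \<in> (\<lambda>f x. - f x) ` B"
    if "f \<in> B" "g \<in> B" "g x < f x" for f g x
    using M_convexD_down[OF assms that] that neg[of _ x] by force
  ultimately show ?thesis by (auto simp: M_convex_def)
qed

theorem inactive_poly_order_independent:
  fixes r r' :: "'a rel"
  assumes "M_convex B" "finite B" "finite A" "linear_order_on A r" "linear_order_on A r'"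
  shows "(\<Sum>f\<in>B. monom (1::int) (card {e \<in> A. \<exists>b\<in>A. (b, e) \<in> r \<and> b \<noteq> e \<and> move f e b \<in> B})) =
         (\<Sum>f\<in>B. monom 1 (card {e \<in> A. \<exists>b\<in>A. (b, e) \<in> r' \<and> b \<noteq> e \<and> move f e b \<in> B}))"
proof -
  obtain xs ys where xs: "sorted_list A r xs" and ys: "sorted_list A r' ys"
    using sorted_list_exists assms by metis
  have "antisym r" "antisym r'" using assms by (auto simp: order_on_defs)
  then show ?thesis
    using inactivity_poly_permute[OF assms(1,2), of xs ys] xs ys
    by (simp add: inactivity_poly_def inactivity_sorted_list) (simp add: sorted_list_def)
qed

section \<open>Hypertrees as an M-convex set\<close>

text \<open>Every edge of \<open>Bip H\<close> appears once, directed towards its hyperedge, so that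
  \<open>degree_at\<close> counts edges by hyperedge.\<close>

definition incidence :: "('v, 'e) pre_hypergraph \<Rightarrow> ('v + 'e) rel" where
  "incidence H = {(Inl v, Inr e) | v e. v \<in> vertices H \<and> e \<in> hyperedges H \<and> v \<in> members H e}"

section \<open>Connectivity and cycles of symmetric digraphs in terms of \<open>join\<close>\<close>

definition graph_of :: "'a set \<Rightarrow> 'a rel \<Rightarrow> 'a pair_pre_digraph" where
  "graph_of V R = \<lparr>pverts = V, parcs = R \<union> R\<inverse>\<rparr>"

lemma graph_of_simps [simp]: "pverts (graph_of V R) = V" "parcs (graph_of V R) = R \<union> R\<inverse>"
  by (simp_all add: graph_of_def)

lemma Bip_eq: "Bip H = graph_of (vertices H <+> hyperedges H) (incidence H)"
  by (auto simp: Bip_def graph_of_def incidence_def)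

lemma pair_graph_graph_of:
  assumes "finite V" "R \<subseteq> V \<times> V" "irrefl R"
  shows "pair_graph (graph_of V R)"
proof
  show "finite (parcs (graph_of V R))"
    using assms finite_subset[OF assms(2)] by simp
  show "symmetric (with_proj (graph_of V R))"
    by (auto simp: symmetric_def sym_def)
qed (use assms in \<open>auto simp: irrefl_def\<close>)

lemma connected_graph_of_iff:
  assumes "R \<subseteq> V \<times> V"
  shows "Digraph_Component.connected (with_proj (graph_of V R)) \<longleftrightarrow> V \<noteq> {} \<and> V \<times> V \<subseteq> join R"
proof -
  have sym: "mk_symmetric (with_proj (graph_of V R)) = graph_of V R"
    by (auto simp: mk_symmetric_def graph_of_def)
  interpret pair_wf_digraph "graph_of V R"
    using assms by unfold_locales auto
  have "reachable (with_proj (graph_of V R)) u v \<longleftrightarrow> (u, v) \<in> join R" if "u \<in> V" for u v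
    using reachable_conv'[of u v] that by (simp add: join_def)
  then show ?thesis
    unfolding Digraph_Component.connected_def sym strongly_connected_def by auto
qed

lemma awalk_join:
  assumes "pair_wf_digraph (graph_of V R)" "pre_digraph.awalk (with_proj (graph_of V R)) u p v"
    "set p \<subseteq> S \<union> S\<inverse>"
  shows "(u, v) \<in> join S"
proof -
  interpret pair_wf_digraph "graph_of V R" by fact
  show ?thesis using assms(2,3)
  proof (induction p arbitrary: u)
    case Nil
    then show ?case by (simp add: awalk_simps join_def)
  next
    case (Cons a p)
    then have "fst a = u" "(snd a, v) \<in> join S" by (auto simp: awalk_simps)
    moreover have "(fst a, snd a) \<in> join S" using Cons.prems by (auto simp: join_def)
    ultimately show ?case by (metis join_trans)
  qed
qed

text \<open>The first edge of a cycle is redundant, since the rest of the cycle avoids it in both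
  directions. Conversely, a redundant edge closes a simple path between its ends.\<close>

lemma cycle_graph_of_iff:
  assumes "R \<subseteq> V \<times> V" "R \<inter> R\<inverse> = {}"
  shows "(\<exists>p. pre_digraph.cycle (with_proj (graph_of V R)) p \<and> 3 \<le> length p) \<longleftrightarrow> \<not> cycle_free R"
    (is "?L \<longleftrightarrow> _")
proof
  interpret pair_wf_digraph "graph_of V R"
    using assms by unfold_locales auto
  have wf: "pair_wf_digraph (graph_of V R)" by unfold_locales
  {
    assume ?L
    then obtain p u where p: "awalk u p u" "distinct (tl (pawalk_verts u p))" "3 \<le> length p"
      by (auto simp: cycle_def)
    obtain v q where pq: "p = (u, v) # q"
      using p by (cases p) (auto simp: awalk_simps)
    have q: "awalk v q u" "distinct (pawalk_verts v q)" "2 \<le> length q" and uv: "(u, v) \<in> R \<union> R\<inverse>"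
      using p pq by (auto simp: awalk_simps)
    obtain a t where qt: "q = a # t" "t \<noteq> []" using q(3) by (cases q) fastforce+
    have t: "fst a = v" "awalk (snd a) t u" "v \<notin> set (pawalk_verts (snd a) t)"
        "distinct (pawalk_verts (snd a) t)"
      using q qt by (auto simp: awalk_simps)
    have vt: "x \<notin> set t" if "fst x = v \<or> snd x = v" for x
      using t(3) that set_awalk_verts[OF t(2)] by auto
    \<comment> \<open>The nonempty walk \<open>t\<close> ends at \<open>u\<close> and repeats no
      vertex, so it cannot start there.\<close>
    have "snd a \<noteq> u"
      using apath_nonempty_ends[of "snd a" t u] t qt by (auto simp: apath_def)
    moreover have "snd a \<noteq> v" using t(3) set_awalk_verts[OF t(2)] by auto
    ultimately have "(u, v) \<notin> set q" "(v, u) \<notin> set q" using vt qt by auto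
    then have "set q \<subseteq> (R - {(u, v), (v, u)}) \<union> (R - {(u, v), (v, u)})\<inverse>"
      using q(1) by (auto simp: awalk_def)
    then have *: "(v, u) \<in> join (R - {(u, v), (v, u)})"
      using awalk_join[OF wf q(1)] by blast
    have "(v, u) \<in> join (R - {(v, u)})" "(v, u) \<in> join (R - {(u, v)})"
      by (rule subsetD[OF join_mono *]; blast)+
    then have "(v, u) \<in> join (R - {(v, u)})" "(u, v) \<in> join (R - {(u, v)})"
      by (auto intro: join_sym)
    with uv show "\<not> cycle_free R" by (auto simp: cycle_free_def)
  }
  {
    assume "\<not> cycle_free R"
    then obtain u v where uv: "(u, v) \<in> R" "(u, v) \<in> join (R - {(u, v)})"
      by (auto simp: cycle_free_def)
    let ?R = "R - {(u, v)}"
    interpret R: pair_wf_digraph "graph_of V ?R"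
      using assms by unfold_locales auto
    have "(v, u) \<in> join ?R" using uv join_sym by metis
    then have "reachable (with_proj (graph_of V ?R)) v u"
      using R.reachable_conv'[of v u] uv assms by (auto simp: join_def)
    then obtain q where q: "R.apath v q u" using R.reachable_apath by auto
    have "u \<noteq> v" using assms uv by blast
    have qR: "set q \<subseteq> ?R \<union> ?R\<inverse>" "pcas v q u" "distinct (pawalk_verts v q)"
      using q by (auto simp: R.apath_def R.awalk_def)
    have "awalk u ((u, v) # q) u"
      using qR uv assms by (auto simp: awalk_def)
    \<comment> \<open>A single arc back would be \<open>(v, u)\<close>, but \<open>(u, v)\<close>
      has been deleted and \<open>R\<close> contains no opposite pairs.\<close>
    moreover have "2 \<le> length q"
    proof -
      have "q \<noteq> []" using qR \<open>u \<noteq> v\<close> by auto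
      moreover have "q \<noteq> [a]" for a
      proof
        assume "q = [a]"
        with qR have "a = (v, u)" by (cases a) auto
        then show False using qR \<open>q = [a]\<close> assms uv by auto
      qed
      ultimately show ?thesis by (cases q; cases "tl q") auto
    qed
    ultimately show ?L
      using qR by (intro exI[of _ "(u, v) # q"]) (auto simp: cycle_def)
  }
qed

lemma incidence_subset: "incidence H \<subseteq> (vertices H <+> hyperedges H) \<times> (vertices H <+> hyperedges H)"
  by (auto simp: incidence_def)

lemma subset_incidenceD:
  "R \<subseteq> incidence H \<Longrightarrow> (x, y) \<in> R \<Longrightarrow> \<exists>v e. x = Inl v \<and> y = Inr e \<and> e \<in> hyperedges H"
  by (auto simp: incidence_def)

lemma finite_incidence:
  assumes "hypergraph H" shows "finite (incidence H)"
  by (rule finite_subset[OF incidence_subset]) (use assms in \<open>auto simp: hypergraph_def\<close>)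

text \<open>As \<open>Bip H\<close> is connected, the closure of \<open>incidence H\<close> contains
  all pairs of nodes; having that same closure then means being connected and spanning.\<close>

lemma spanning_tree_iff_basis:
  assumes "hypergraph H" and conn: "Digraph_Component.connected (with_proj (Bip H))"
  shows "undirected_spanning_tree T (Bip H) \<longleftrightarrow>
    (\<exists>R. basis (incidence H) R \<and> T = graph_of (vertices H <+> hyperedges H) R)"
    (is "_ \<longleftrightarrow> (\<exists>R. _ \<and> T = graph_of ?V R)")
proof -
  let ?I = "incidence H"
  have finV: "finite ?V" using assms by (auto simp: hypergraph_def)
  have I: "?V \<noteq> {}" "?V \<times> ?V \<subseteq> join ?I"
    using conn connected_graph_of_iff[OF incidence_subset, of H] unfolding Bip_eq by auto
  have tree: "undirected_spanning_tree (graph_of ?V R) (Bip H) \<longleftrightarrow> basis ?I R" if R: "R \<subseteq> ?I" for R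
  proof -
    have RV: "R \<subseteq> ?V \<times> ?V" using R incidence_subset by blast
    have disj: "R \<inter> R\<inverse> = {}" by (auto dest: subset_incidenceD[OF R])
    have irr: "irrefl R" by (auto simp: irrefl_def dest: subset_incidenceD[OF R])
    have wf: "pair_wf_digraph (graph_of ?V R)" if "R \<subseteq> ?V \<times> ?V" for R
      using that by unfold_locales auto
    have "spanning (with_proj (graph_of ?V R)) (with_proj (Bip H))"
      using R wf[OF RV] wf[OF incidence_subset]
      by (auto simp: spanning_def subgraph_def Bip_eq wf_digraph_wp_iff)
    moreover have "join R = join ?I \<longleftrightarrow> ?V \<times> ?V \<subseteq> join R"
    proof
      assume "?V \<times> ?V \<subseteq> join R"
      then have "join ?I \<subseteq> join R" using incidence_subset by (auto simp: join_subset_iff)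
      with join_mono[OF R] show "join R = join ?I" by blast
    qed (use I in simp)
    ultimately show ?thesis
      using cycle_graph_of_iff[OF RV disj] connected_graph_of_iff[OF RV] I(1) R
        pair_graph_graph_of[OF finV RV irr]
      by (simp add: undirected_spanning_tree_def undirected_tree_def basis_def)
  qed
  have "\<exists>R\<subseteq>?I. T = graph_of ?V R" if "undirected_spanning_tree T (Bip H)"
  proof -
    have T: "pair_graph T" "pverts T = ?V" "parcs T \<subseteq> ?I \<union> ?I\<inverse>"
      using that by (auto simp: undirected_spanning_tree_def undirected_tree_def spanning_def
          subgraph_def Bip_eq)
    interpret pair_graph T by fact
    \<comment> \<open>By symmetry \<open>T\<close> is recovered from its arcs that point towards
      hyperedges.\<close>
    have "sym (parcs T)" using sym_arcs by (simp add: symmetric_def)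
    then have "parcs T = (parcs T \<inter> ?I) \<union> (parcs T \<inter> ?I)\<inverse>" using T(3) by (auto dest: symD)
    with T(2) have "T = graph_of ?V (parcs T \<inter> ?I)" by (simp add: graph_of_def)
    then show ?thesis by blast
  qed
  with tree show ?thesis unfolding basis_def by metis
qed

section \<open>Hypertrees as integer vectors of tree degrees\<close>

lemma out_degree_graph_of:
  assumes "R \<subseteq> incidence H"
  shows "int (out_degree (with_proj (graph_of V R)) (Inr e)) = degree_at R (Inr e)"
proof -
  have "out_arcs (with_proj (graph_of V R)) (Inr e) = prod.swap ` {p \<in> R. snd p = Inr e}"
    by (auto simp: out_arcs_def image_iff dest: subset_incidenceD[OF assms])
  then show ?thesis
    by (simp add: out_degree_def degree_at_def card_image)
qed

lemma hypertrees_iff_basis: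
  assumes "hypergraph H" "Digraph_Component.connected (with_proj (Bip H))"
  shows "f \<in> hypertrees H \<longleftrightarrow> f \<in> hyperedges H \<rightarrow>\<^sub>E UNIV \<and>
    (\<exists>R. basis (incidence H) R \<and> (\<forall>e\<in>hyperedges H. degree_at R (Inr e) = int (f e) + 1))"
proof -
  have eq: "(\<forall>e\<in>hyperedges H. degree_at R (Inr e) = int (f e) + 1) \<longleftrightarrow>
    (\<forall>e\<in>hyperedges H. out_degree (with_proj (graph_of V R)) (Inr e) = f e + 1)"
    if "basis (incidence H) R" for R V
  proof -
    have "int (out_degree (with_proj (graph_of V R)) (Inr e)) = degree_at R (Inr e)" for e
      using that out_degree_graph_of by (auto simp: basis_def)
    then have "degree_at R (Inr e) = int (f e) + 1 \<longleftrightarrow>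
        out_degree (with_proj (graph_of V R)) (Inr e) = f e + 1" for e
      by (metis of_nat_1 of_nat_add of_nat_eq_iff)
    then show ?thesis by simp
  qed
  show ?thesis
    unfolding hypertrees_def mem_Collect_eq spanning_tree_iff_basis[OF assms] using eq by blast
qed

text \<open>Integer values keep moves free of truncated subtraction and allow negation.\<close>

definition hypertree_vectors :: "('v, 'e) pre_hypergraph \<Rightarrow> ('e \<Rightarrow> int) set" where
  "hypertree_vectors H = (\<lambda>f e. int (f e)) ` hypertrees H"

lemma hypertree_vectorsI: "f \<in> hypertrees H \<Longrightarrow> (\<lambda>e. int (f e)) \<in> hypertree_vectors H"
  by (simp add: hypertree_vectors_def)

lemma degree_at_eq_0:
  assumes "R \<subseteq> incidence H" "z \<notin> Inr ` hyperedges H"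
  shows "degree_at R z = 0"
proof -
  have "{p \<in> R. snd p = z} = {}" using assms(2) by (auto dest: subset_incidenceD[OF assms(1)])
  then show ?thesis by (simp only: degree_at_def card.empty of_nat_0)
qed

lemma hypertree_move:
  assumes H: "hypergraph H" "Digraph_Component.connected (with_proj (Bip H))"
    and f: "f \<in> hypertrees H" and R: "basis (incidence H) R"
      "\<forall>e\<in>hyperedges H. degree_at R (Inr e) = int (f e) + 1"
    and U: "basis (incidence H) U" "degree_at U = move (degree_at R) (Inr a) (Inr b)"
    and ab: "a \<in> hyperedges H" "b \<in> hyperedges H" "a \<noteq> b" "0 < f a"
  shows "move (\<lambda>e. int (f e)) a b \<in> hypertree_vectors H"
proof -
  let ?g = "f(a := f a - 1, b := f b + 1)"
  have "?g \<in> hypertrees H"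
    unfolding hypertrees_iff_basis[OF H]
  proof (intro conjI exI[of _ U])
    show "?g \<in> hyperedges H \<rightarrow>\<^sub>E UNIV" using f ab by (auto simp: hypertrees_def PiE_iff extensional_def)
    show "\<forall>e\<in>hyperedges H. degree_at U (Inr e) = int (?g e) + 1"
      using R U ab by (auto simp: move_def)
  qed (rule U)
  moreover have "move (\<lambda>e. int (f e)) a b = (\<lambda>e. int (?g e))" using ab by (auto simp: move_def)
  ultimately show ?thesis by (simp only: hypertree_vectorsI)
qed

text \<open>Trees realising \<open>f\<close> and \<open>g\<close> are compared by degree exchange.
  The shift by one between degrees and hypertree values affects neither inequalities nor
  moves.\<close>

lemma hypertree_vectors_M_convex:
  assumes H: "hypergraph H" "Digraph_Component.connected (with_proj (Bip H))"
  shows "M_convex (hypertree_vectors H)"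
proof -
  let ?I = "incidence H"
  have fin: "finite ?I" using finite_incidence H(1) by blast
  have ext: "f e = g e" if "f \<in> hypertrees H" "g \<in> hypertrees H" "e \<notin> hyperedges H" for f g e
    using that by (simp add: hypertrees_def PiE_iff extensional_def)
  \<comment> \<open>Outside the hyperedge nodes \<open>degree_at\<close> vanishes for both trees, so
    exchange can only select a hyperedge.\<close>
  have mem: "\<exists>e\<in>hyperedges H. z = Inr e" if "basis ?I R" "basis ?I R'" "degree_at R z < degree_at R' z"
    for R R' z
  proof (rule ccontr)
    assume "\<not> ?thesis"
    then have "z \<notin> Inr ` hyperedges H" by blast
    then have "degree_at R z = 0" "degree_at R' z = 0"
      using that(1,2) degree_at_eq_0 unfolding basis_def by blast+
    with that(3) show False by simp
  qed
  have "\<exists>y. f y < g y \<and> move (\<lambda>e. int (f e)) x y \<in> hypertree_vectors H"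
    if fg: "f \<in> hypertrees H" "g \<in> hypertrees H" "g x < f x" for f g x
  proof -
    have x: "x \<in> hyperedges H" using ext[OF fg(1,2)] fg(3) by (metis less_irrefl)
    obtain R R' where R: "basis ?I R" "\<forall>e\<in>hyperedges H. degree_at R (Inr e) = int (f e) + 1"
      and R': "basis ?I R'" "\<forall>e\<in>hyperedges H. degree_at R' (Inr e) = int (g e) + 1"
      using fg hypertrees_iff_basis[OF H] by metis
    have lt: "degree_at R' (Inr x) < degree_at R (Inr x)" using R(2) R'(2) x fg(3) by simp
    obtain z U where z: "degree_at R z < degree_at R' z"
      and U: "basis ?I U" "degree_at U = move (degree_at R) (Inr x) z"
      using degree_exchange_down[OF fin R(1) R'(1) lt] by blast
    obtain y where y: "y \<in> hyperedges H" "z = Inr y" using mem[OF R(1) R'(1) z] by blast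
    have "f y < g y" using z y R(2) R'(2) by simp
    moreover from this have "x \<noteq> y" using fg by auto
    ultimately show ?thesis using hypertree_move[OF H fg(1) R U(1)] U(2) x y fg(3) by auto
  qed
  moreover have "\<exists>y. g y < f y \<and> move (\<lambda>e. int (f e)) y x \<in> hypertree_vectors H"
    if fg: "f \<in> hypertrees H" "g \<in> hypertrees H" "f x < g x" for f g x
  proof -
    have x: "x \<in> hyperedges H" using ext[OF fg(1,2)] fg(3) by (metis less_irrefl)
    obtain R R' where R: "basis ?I R" "\<forall>e\<in>hyperedges H. degree_at R (Inr e) = int (f e) + 1"
      and R': "basis ?I R'" "\<forall>e\<in>hyperedges H. degree_at R' (Inr e) = int (g e) + 1"
      using fg hypertrees_iff_basis[OF H] by metis
    have lt: "degree_at R (Inr x) < degree_at R' (Inr x)" using R(2) R'(2) x fg(3) by simp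
    obtain z U where z: "degree_at R' z < degree_at R z"
      and U: "basis ?I U" "degree_at U = move (degree_at R) z (Inr x)"
      using degree_exchange_up[OF fin R(1) R'(1) lt] by blast
    obtain y where y: "y \<in> hyperedges H" "z = Inr y" using mem[OF R'(1) R(1) z] by blast
    have "g y < f y" using z y R(2) R'(2) by simp
    moreover from this have "x \<noteq> y" using fg by auto
    ultimately show ?thesis using hypertree_move[OF H fg(1) R U(1)] U(2) x y by auto
  qed
  ultimately show ?thesis by (simp add: M_convex_def hypertree_vectors_def)
qed

text \<open>Positivity of \<open>f a\<close> comes for free in the integer form:
  \<open>f a - 1\<close> is a value of a hypertree and hence nonnegative.\<close>

lemma transfer_possible_iff_move:
  assumes "f \<in> hypertrees H" "a \<in> hyperedges H" "b \<in> hyperedges H" "a \<noteq> b"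
  shows "transfer_possible H f a b \<longleftrightarrow> move (\<lambda>e. int (f e)) a b \<in> hypertree_vectors H"
proof
  let ?g = "f(a := f a - 1, b := f b + 1)"
  have move: "move (\<lambda>e. int (f e)) a b = (\<lambda>e. int (?g e))" if "0 < f a"
    using that assms by (auto simp: move_def)
  show "transfer_possible H f a b \<Longrightarrow> move (\<lambda>e. int (f e)) a b \<in> hypertree_vectors H"
    using move hypertree_vectorsI[of ?g H] by (simp only: transfer_possible_def)
  assume "move (\<lambda>e. int (f e)) a b \<in> hypertree_vectors H"
  then obtain g where g: "g \<in> hypertrees H" "move (\<lambda>e. int (f e)) a b = (\<lambda>e. int (g e))"
    by (auto simp: hypertree_vectors_def)
  have "int (f a) - 1 = int (g a)" using fun_cong[OF g(2), of a] assms by (simp add: move_def)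
  then have "0 < f a" by linarith
  with g have "(\<lambda>e. int (?g e)) = (\<lambda>e. int (g e))" using move by simp
  then have "?g = g" by (simp add: fun_eq_iff del: fun_upd_apply)
  with g \<open>0 < f a\<close> assms show "transfer_possible H f a b" by (simp add: transfer_possible_def)
qed

lemma inj_int_comp: "inj_on (\<lambda>f e. int (f e)) A" "inj_on (\<lambda>f e. - int (f e)) A"
  by (auto simp: inj_on_def fun_eq_iff)

lemma interior_polynomial_eq:
  "interior_polynomial H r = (\<Sum>f\<in>hypertree_vectors H. monom 1 (card {e \<in> hyperedges H.
     \<exists>b\<in>hyperedges H. (b, e) \<in> r \<and> b \<noteq> e \<and> move f e b \<in> hypertree_vectors H}))"
proof -
  have "internally_inactive H r f = {e \<in> hyperedges H. \<exists>b\<in>hyperedges H. (b, e) \<in> r \<and> b \<noteq> e \<and>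
    move (\<lambda>e. int (f e)) e b \<in> hypertree_vectors H}" if "f \<in> hypertrees H" for f
    using transfer_possible_iff_move[OF that] by (auto simp: internally_inactive_def)
  then show ?thesis
    by (simp add: interior_polynomial_def hypertree_vectors_def sum.reindex inj_int_comp)
qed

text \<open>Receiving a unit in \<open>f\<close> is giving one in the negated vector, so external
  inactivity becomes internal inactivity over \<open>B\<close>.\<close>

lemma exterior_polynomial_eq:
  fixes H :: "('v, 'e) pre_hypergraph"
  defines "B \<equiv> (\<lambda>f e. - f e) ` hypertree_vectors H"
  shows "exterior_polynomial H r = (\<Sum>f\<in>B. monom 1 (card {e \<in> hyperedges H.
     \<exists>b\<in>hyperedges H. (b, e) \<in> r \<and> b \<noteq> e \<and> move f e b \<in> B}))"
proof -
  have neg: "move (\<lambda>e. - f e) a b \<in> B \<longleftrightarrow> move f b a \<in> hypertree_vectors H" if "a \<noteq> b"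
    for f :: "'e \<Rightarrow> int" and a b
  proof -
    have "move (\<lambda>e. - f e) a b = (\<lambda>e. - move f b a e)" using that by (auto simp: move_def)
    moreover have "inj (\<lambda>(f :: 'e \<Rightarrow> int) e. - f e)" by (auto simp: inj_def fun_eq_iff)
    note inj_image_mem_iff[OF this, of "move f b a" "hypertree_vectors H"]
    ultimately show ?thesis by (simp only: B_def)
  qed
  have "externally_inactive H r f = {e \<in> hyperedges H. \<exists>b\<in>hyperedges H. (b, e) \<in> r \<and> b \<noteq> e \<and>
    move (\<lambda>e. - int (f e)) e b \<in> B}" if "f \<in> hypertrees H" for f
    using transfer_possible_iff_move[OF that] neg by (auto simp: externally_inactive_def)
  moreover have "B = (\<lambda>f e. - int (f e)) ` hypertrees H"
    by (auto simp: B_def hypertree_vectors_def image_image)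
  ultimately show ?thesis
    by (simp add: exterior_polynomial_def sum.reindex inj_int_comp)
qed

theorem theorem5p4:
  fixes H :: "('v, 'e) pre_hypergraph" and r r' :: "'e rel"
  assumes "hypergraph H"
    and "Digraph_Component.connected (with_proj (Bip H))"
    and "linear_order_on (hyperedges H) r"
    and "linear_order_on (hyperedges H) r'"
  shows "interior_polynomial H r = interior_polynomial H r' \<and>
         exterior_polynomial H r = exterior_polynomial H r'"
proof
  let ?B = "hypertree_vectors H"
  have B: "M_convex ?B" "finite ?B" and fin: "finite (hyperedges H)"
    using hypertree_vectors_M_convex[OF assms(1,2)] finite_hypertrees[OF assms(1)] assms(1)
    by (auto simp: hypertree_vectors_def hypergraph_def)
  show "interior_polynomial H r = interior_polynomial H r'"
    unfolding interior_polynomial_eq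
    by (rule inactive_poly_order_independent[OF B fin assms(3,4)])
  show "exterior_polynomial H r = exterior_polynomial H r'"
    unfolding exterior_polynomial_eq
    by (rule inactive_poly_order_independent[OF M_convex_uminus[OF B(1)] finite_imageI[OF B(2)] fin assms(3,4)])
qed

end
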